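(* Let $\mathbb{F}$ be a field, $d\geq 2$ an integer, $t$ a positive integer, and $E$ a finite subset of $\mathbb{F}^d$ that spans $\mathbb{F}^d$. If there is a linear subspace $S_0$ of $\mathbb{F}^d$ satisfying $|E|-|E\cap S_0|<t\,(d-\dim S_0)$, then $ar_\ell(E,t)=|E|$. Otherwise, $$ar_\ell(E,t)=\max_{S\colon \dim S\leq d-2}\{|S\cap E|+t\,(d-\dim S-1)\},$$ where the maximum is taken over all linear subspaces $S$ of $\mathbb{F}^d$ of dimension at most $d-2$.
   Context: A basis of $E$ means a linearly independent subset of $E$ of size $d$ (i.e. a basis of $\mathbb{F}^d$ consisting of elements of $E$). Given a coloring of $E$, a rainbow basis is such a basis whose elements have pairwise distinct colors. $ar_\ell(E,t)$ is the maximum number $m$ such that there is a coloring of $E$ with exactly $m$ colors containing no $t$ pairwise disjoint rainbow bases. *)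

theory Defs
  imports "HOL-Analysis.Analysis"
begin

definition basis_of :: "('a::field ^ 'n) set \<Rightarrow> ('a ^ 'n) set \<Rightarrow> bool" where
  "basis_of E B \<longleftrightarrow> B \<subseteq> E \<and> vec.independent B \<and> card B = CARD('n)"

definition rainbow_basis :: "('a::field ^ 'n) set \<Rightarrow> ('a ^ 'n \<Rightarrow> nat) \<Rightarrow> ('a ^ 'n) set \<Rightarrow> bool" where
  "rainbow_basis E c B \<longleftrightarrow> basis_of E B \<and> inj_on c B"

text \<open>Each basis in the family has to be rainbow on its own; a color may recur in different bases.\<close>

definition has_disjoint_rainbow_bases ::
    "('a::field ^ 'n) set \<Rightarrow> ('a ^ 'n \<Rightarrow> nat) \<Rightarrow> nat \<Rightarrow> bool" where
  "has_disjoint_rainbow_bases E c t \<longleftrightarrow>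
     (\<exists>\<B>. finite \<B> \<and> card \<B> = t \<and> (\<forall>B\<in>\<B>. rainbow_basis E c B) \<and> pairwise disjnt \<B>)"

definition avoiding_color_numbers :: "('a::field ^ 'n) set \<Rightarrow> nat \<Rightarrow> nat set" where
  "avoiding_color_numbers E t =
     {m. \<exists>c. card (c ` E) = m \<and> \<not> has_disjoint_rainbow_bases E c t}"

definition ar_l :: "('a::field ^ 'n) set \<Rightarrow> nat \<Rightarrow> nat" where
  "ar_l E t = Max (avoiding_color_numbers E t)"

text \<open>The maxima in the definition above and in the formula for it are over nonempty finite
  sets of numbers, also when the field is infinite.\<close>

lemma finite_avoiding_color_numbers:
  assumes "finite E"
  shows "finite (avoiding_color_numbers E t)"
proof (rule finite_subset)
  show "avoiding_color_numbers E t \<subseteq> {..card E}"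
    using assms by (auto simp: avoiding_color_numbers_def card_image_le)
qed simp

lemma avoiding_color_numbers_nonempty:
  fixes E :: "('a::field ^ 'n) set"
  assumes "CARD('n) \<ge> 2" "t > 0"
  shows "avoiding_color_numbers E t \<noteq> {}"
proof -
  have "\<not> rainbow_basis E (\<lambda>_. 0) B" for B
  proof
    assume B: "rainbow_basis E (\<lambda>_. 0) B"
    then have "card B \<le> card {0::nat}"
      by (intro card_inj_on_le[of "\<lambda>_. 0"]) (auto simp: rainbow_basis_def)
    with B assms(1) show False
      by (simp add: rainbow_basis_def basis_of_def)
  qed
  then have "\<not> has_disjoint_rainbow_bases E (\<lambda>_. 0) t"
    using assms(2) by (auto simp: has_disjoint_rainbow_bases_def card_gt_0_iff)
  then show ?thesis
    by (auto simp: avoiding_color_numbers_def)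
qed

lemma finite_subspace_values:
  fixes E :: "('a::field ^ 'n) set"
  assumes "finite E"
  shows "finite {card (S \<inter> E) + t * (CARD('n) - vec.dim S - 1) | S.
                   vec.subspace S \<and> vec.dim S \<le> CARD('n) - 2}"
proof (rule finite_subset)
  show "{card (S \<inter> E) + t * (CARD('n) - vec.dim S - 1) | S.
           vec.subspace S \<and> vec.dim S \<le> CARD('n) - 2} \<subseteq> {..card E + t * CARD('n)}"
    using assms by (auto intro!: add_mono mult_le_mono card_mono)
qed simp

lemma subspace_values_nonempty:
  fixes E :: "('a::field ^ 'n) set"
  shows "{card (S \<inter> E) + t * (CARD('n) - vec.dim S - 1) | S.
            vec.subspace S \<and> vec.dim S \<le> CARD('n) - 2} \<noteq> {}"
proof -
  have "vec.subspace ({0} :: ('a ^ 'n) set)" "vec.dim ({0} :: ('a ^ 'n) set) \<le> CARD('n) - 2"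
    by (simp_all add: vec.subspace_0)
  then show ?thesis by blast
qed

end

theory Submission
  imports Defs
begin

text \<open>
  Write \<open>d\<close> for the dimension of the space.  For the upper bound, consider a coloring with more
  colors than the formula allows.  For every subspace \<open>S \<noteq> UNIV\<close>, at least
  \<open>t (d - dim S - 1) + 1\<close> colors then occur outside \<open>S\<close>, so a defect version of Rado's theorem yields \<open>t\<close> independent sets
  whose union is rainbow with more than \<open>t (d - 1)\<close> elements.  The same theorem with pairwise distinct
  colors gives \<open>t\<close> disjoint bases, and by the exchange property of the matroid union there are \<open>t\<close>
  disjoint bases whose union contains the rainbow set.  If one of them repeats a color, then
  one of the others shares no color with it (otherwise the union would have at most \<open>t (d - 1)\<close>
  colors), and a symmetric exchange between these two lowers the number of repetitions.

  The lower bound is attained by coloring \<open>S \<inter> E\<close> and \<open>t (d - dim S - 1) - 1\<close> further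
  elements injectively and everything else with one additional color.
\<close>

section \<open>Rado's theorem with defect for submodular functions\<close>

text \<open>A smallest \<open>V\<close> that still satisfies all the \<open>defect\<close>
  inequalities is already rainbow: if two of its elements had the same color, deleting either one
  would violate some inequality, and the two violations together contradict submodularity. The
  inequality for \<open>K = J\<close> then bounds \<open>\<rho> V\<close> from below.\<close>

lemma rado_defect:
  fixes \<rho> :: "'b set \<Rightarrow> nat" and \<kappa> :: "'b \<Rightarrow> 'c"
  assumes "finite W" and "finite J"
    and mono: "\<And>A B. A \<subseteq> B \<Longrightarrow> B \<subseteq> W \<Longrightarrow> \<rho> A \<le> \<rho> B"
    and submodular: "\<And>A B. A \<subseteq> W \<Longrightarrow> B \<subseteq> W \<Longrightarrow> \<rho> (A \<union> B) + \<rho> (A \<inter> B) \<le> \<rho> A + \<rho> B"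
    and defect: "\<And>K. K \<subseteq> J \<Longrightarrow> R \<le> \<rho> {w \<in> W. \<kappa> w \<in> K} + card (J - K)"
  shows "\<exists>V\<subseteq>W. inj_on \<kappa> V \<and> R \<le> \<rho> V"
proof -
  define Q where "Q V \<longleftrightarrow> V \<subseteq> W \<and> (\<forall>K\<subseteq>J. R \<le> \<rho> {w \<in> V. \<kappa> w \<in> K} + card (J - K))" for V
  have "Q W" using defect by (simp add: Q_def)
  then obtain V where V: "Q V" and minimal: "\<And>V'. Q V' \<Longrightarrow> card V \<le> card V'"
    using ex_has_least_nat[of Q W card] by blast
  then have "V \<subseteq> W" "finite V" using \<open>finite W\<close> finite_subset by (auto simp: Q_def)
  have blocked: "\<exists>K\<subseteq>J. \<kappa> v \<in> K \<and> \<rho> {w \<in> V - {v}. \<kappa> w \<in> K} + card (J - K) < R" if "v \<in> V" for v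
  proof -
    have "card (V - {v}) < card V" using that \<open>finite V\<close> by (rule card_Diff1_less[rotated])
    then have "\<not> Q (V - {v})" using minimal by (meson not_less)
    then obtain K where K: "K \<subseteq> J" "\<rho> {w \<in> V - {v}. \<kappa> w \<in> K} + card (J - K) < R"
      using \<open>V \<subseteq> W\<close> unfolding Q_def by (meson Diff_subset not_less order_trans)
    have "\<kappa> v \<in> K"
    proof (rule ccontr)
      assume "\<kappa> v \<notin> K"
      then have "{w \<in> V - {v}. \<kappa> w \<in> K} = {w \<in> V. \<kappa> w \<in> K}" by auto
      with K V show False unfolding Q_def by (metis not_less)
    qed
    with K show ?thesis by blast
  qed
  have "inj_on \<kappa> V"
  proof (rule inj_onI, rule ccontr)
    fix x y assume xy: "x \<in> V" "y \<in> V" "\<kappa> x = \<kappa> y" "x \<noteq> y"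
    from blocked[OF xy(1)] obtain K
      where K: "K \<subseteq> J" "\<kappa> x \<in> K" "\<rho> {w \<in> V - {x}. \<kappa> w \<in> K} + card (J - K) < R" by blast
    from blocked[OF xy(2)] obtain L
      where L: "L \<subseteq> J" "\<kappa> x \<in> L" "\<rho> {w \<in> V - {y}. \<kappa> w \<in> L} + card (J - L) < R"
      unfolding xy(3)[symmetric] by blast
    let ?A = "{w \<in> V - {x}. \<kappa> w \<in> K}" and ?B = "{w \<in> V - {y}. \<kappa> w \<in> L}"
    \<comment> \<open>Elements of \<open>V\<close> with a color in \<open>?M\<close> differ from
      \<open>x\<close> and \<open>y\<close>, so they lie in \<open>?A \<inter> ?B\<close>. Dropping
      the common color adds one to the count of missing colors, but the two strict inequalities have
      a total slack of two.\<close>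
    let ?M = "K \<inter> L - {\<kappa> x}"
    have un: "?A \<union> ?B = {w \<in> V. \<kappa> w \<in> K \<union> L}"
      using xy K(2) L(2) by auto
    have Q: "R \<le> \<rho> {w \<in> V. \<kappa> w \<in> M} + card (J - M)" if "M \<subseteq> J" for M
      using V that by (simp add: Q_def)
    have "\<rho> {w \<in> V. \<kappa> w \<in> ?M} \<le> \<rho> (?A \<inter> ?B)"
      using \<open>V \<subseteq> W\<close> xy by (intro mono) auto
    moreover have "\<rho> (?A \<union> ?B) + \<rho> (?A \<inter> ?B) \<le> \<rho> ?A + \<rho> ?B"
      using \<open>V \<subseteq> W\<close> by (intro submodular) auto
    moreover have "R \<le> \<rho> {w \<in> V. \<kappa> w \<in> K \<union> L} + card (J - (K \<union> L))"
      using K(1) L(1) by (intro Q) auto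
    moreover have "R \<le> \<rho> {w \<in> V. \<kappa> w \<in> ?M} + card (J - ?M)"
      using K(1) by (intro Q) auto
    moreover have "card (J - (K \<union> L)) + card (J - ?M) = Suc (card (J - K) + card (J - L))"
    proof -
      have "J - ?M = insert (\<kappa> x) ((J - K) \<union> (J - L))" using K L by auto
      moreover have "J - (K \<union> L) = (J - K) \<inter> (J - L)" by auto
      ultimately show ?thesis
        using \<open>finite J\<close> K(2) L(2) card_Un_Int[of "J - K" "J - L"] by simp
    qed
    ultimately show False using K(3) L(3) un by simp
  qed
  moreover have "R \<le> \<rho> V"
  proof -
    have "R \<le> \<rho> {w \<in> V. \<kappa> w \<in> J}" using V by (auto simp: Q_def)
    also have "\<dots> \<le> \<rho> V" using \<open>V \<subseteq> W\<close> by (intro mono) auto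
    finally show ?thesis .
  qed
  ultimately show ?thesis using \<open>V \<subseteq> W\<close> by blast
qed

section \<open>Rainbow families of independent sets\<close>

lemma dim_Un_Int_le:
  fixes A B :: "('a::field ^ 'n) set"
  shows "vec.dim (A \<union> B) + vec.dim (A \<inter> B) \<le> vec.dim A + vec.dim B"
proof -
  let ?S = "vec.span A" and ?T = "vec.span B"
  have "vec.dim (A \<union> B) = vec.dim {x + y |x y. x \<in> ?S \<and> y \<in> ?T}"
    unfolding vec.span_Un[symmetric] by simp
  moreover have "vec.dim (A \<inter> B) \<le> vec.dim (?S \<inter> ?T)"
    by (intro vec.dim_subset) (auto intro: vec.span_base)
  moreover have "vec.dim {x + y |x y. x \<in> ?S \<and> y \<in> ?T} + vec.dim (?S \<inter> ?T) = vec.dim A + vec.dim B"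
    using vec.dim_sums_Int[of ?S ?T] by simp
  ultimately show ?thesis by linarith
qed

text \<open>This is \<open>rado_defect\<close> for \<open>t\<close> labelled copies of
  \<open>E\<close>, with the sum of the dimensions of the layers as \<rho>. All copies of an element
  carry its color, so a rainbow choice contains at most one of them; this makes the independent sets
  taken from the layers disjoint.\<close>

lemma rainbow_independent_family:
  fixes E :: "('a::field ^ 'n) set" and c :: "'a ^ 'n \<Rightarrow> 'c"
  assumes "finite E"
    and colors: "\<And>S. vec.subspace S \<Longrightarrow> R \<le> card (c ` (E - S)) + t * vec.dim S"
  shows "\<exists>I. (\<forall>i<t. I i \<subseteq> E \<and> vec.independent (I i)) \<and> disjoint_family_on I {..<t} \<and>
             inj_on c (\<Union>i<t. I i) \<and> R \<le> (\<Sum>i<t. card (I i))"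
proof -
  define layer where "layer i Z = {e. (e, i) \<in> Z}" for i :: nat and Z :: "(('a ^ 'n) \<times> nat) set"
  define \<rho> where "\<rho> Z = (\<Sum>i<t. vec.dim (layer i Z))" for Z
  let ?W = "E \<times> {..<t}"
  have "\<exists>V\<subseteq>?W. inj_on (c \<circ> fst) V \<and> R \<le> \<rho> V"
  proof (rule rado_defect[of ?W "c ` E"])
    show "\<rho> A \<le> \<rho> B" if "A \<subseteq> B" for A B
      using that unfolding \<rho>_def layer_def by (intro sum_mono vec.dim_subset) auto
    show "\<rho> (A \<union> B) + \<rho> (A \<inter> B) \<le> \<rho> A + \<rho> B" for A B
    proof -
      have "layer i (A \<union> B) = layer i A \<union> layer i B" "layer i (A \<inter> B) = layer i A \<inter> layer i B" for i
        by (auto simp: layer_def)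
      then show ?thesis
        unfolding \<rho>_def sum.distrib[symmetric] by (simp add: sum_mono dim_Un_Int_le)
    qed
    show "R \<le> \<rho> {w \<in> ?W. (c \<circ> fst) w \<in> K} + card (c ` E - K)" if "K \<subseteq> c ` E" for K
    proof -
      let ?EK = "{e \<in> E. c e \<in> K}"
      have "layer i {w \<in> ?W. (c \<circ> fst) w \<in> K} = ?EK" if "i < t" for i
        using that by (auto simp: layer_def)
      then have "\<rho> {w \<in> ?W. (c \<circ> fst) w \<in> K} = t * vec.dim (vec.span ?EK)"
        by (simp add: \<rho>_def)
      \<comment> \<open>An element of \<open>E\<close> outside the span is not in
        \<open>?EK\<close>, so its color is not in \<open>K\<close>. Hence a condition on subspaces
        covers all sets of colors.\<close>
      moreover have "card (c ` (E - vec.span ?EK)) \<le> card (c ` E - K)"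
        using \<open>finite E\<close> by (intro card_mono) (auto intro: vec.span_base)
      ultimately show ?thesis
        using colors[OF vec.subspace_span, of ?EK] by linarith
    qed
  qed (use \<open>finite E\<close> in auto)
  then obtain V where V: "V \<subseteq> ?W" "inj_on (c \<circ> fst) V" "R \<le> \<rho> V" by blast
  have "\<exists>B\<subseteq>layer i V. vec.independent B \<and> card B = vec.dim (layer i V)" for i
    by (metis vec.basis_exists)
  then obtain I where I: "\<And>i. I i \<subseteq> layer i V" "\<And>i. vec.independent (I i)"
      "\<And>i. card (I i) = vec.dim (layer i V)"
    by metis
  have unique: "e = e' \<and> i = i'" if "e \<in> I i" "e' \<in> I i'" "c e = c e'" for e e' i i'
  proof -
    have "(e, i) \<in> V" "(e', i') \<in> V" using that I(1) by (auto simp: layer_def)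
    with that(3) inj_onD[OF V(2)] show ?thesis by fastforce
  qed
  have "I i \<subseteq> E" if "i < t" for i
    using I(1)[of i] V(1) by (auto simp: layer_def)
  moreover have "disjoint_family_on I {..<t}"
    unfolding disjoint_family_on_def using unique by blast
  moreover have "inj_on c (\<Union>i<t. I i)"
    using unique by (auto intro!: inj_onI)
  moreover have "R \<le> (\<Sum>i<t. card (I i))"
    using V(3) by (simp add: \<rho>_def I(3))
  ultimately show ?thesis using I(2) by blast
qed

section \<open>Exchange between disjoint bases\<close>

text \<open>An indexed family, unlike the set of bases in \<open>has_disjoint_rainbow_bases\<close>,
  lets exchanges update single members and lets the members be summed over.\<close>

definition disjoint_bases :: "('a::field ^ 'n) set \<Rightarrow> nat \<Rightarrow> (nat \<Rightarrow> ('a ^ 'n) set) \<Rightarrow> bool" where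
  "disjoint_bases E t B \<longleftrightarrow> (\<forall>i<t. basis_of E (B i)) \<and> disjoint_family_on B {..<t}"

lemma basis_of_finite: "basis_of E B \<Longrightarrow> finite B"
  by (simp add: basis_of_def vec.finiteI_independent)

lemma basis_of_span:
  fixes B :: "('a::field ^ 'n) set"
  assumes "basis_of E B"
  shows "vec.span B = UNIV"
proof -
  have "vec.dim B = CARD('n)"
    using assms by (simp add: basis_of_def vec.dim_eq_card_independent)
  then show ?thesis
    by (metis vec.dim_eq_full vec.dim_UNIV vec.dimension_def vec_dim_card)
qed

text \<open>Among the disjoint families of independent sets that cover the given elements, take one
  with the largest total overlap with \<open>B\<close>. If its member \<open>i\<close> does not
  span, some \<open>e\<close> in \<open>B i\<close> can be added to it and removed from any other
  member. Everything covered stays covered and the overlap grows.\<close>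

lemma extend_to_disjoint_bases:
  fixes E :: "('a::field ^ 'n) set"
  assumes B: "disjoint_bases E t B"
    and I: "\<forall>i<t. I i \<subseteq> E \<and> vec.independent (I i)" "disjoint_family_on I {..<t}"
  shows "\<exists>B'. disjoint_bases E t B' \<and> (\<Union>i<t. I i) \<subseteq> (\<Union>i<t. B' i)"
proof -
  let ?Z = "\<Union>i<t. I i"
  define P where "P I' \<longleftrightarrow> (\<forall>i<t. I' i \<subseteq> E \<and> vec.independent (I' i)) \<and> disjoint_family_on I' {..<t} \<and>
      ?Z \<subseteq> (\<Union>i<t. I' i)" for I'
  define overlap where "overlap I' = (\<Sum>i<t. card (I' i \<inter> B i))" for I'
  have Bi: "basis_of E (B i)" if "i < t" for i
    using B that by (simp add: disjoint_bases_def)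
  have "overlap I' < Suc (\<Sum>i<t. card (B i))" for I'
    unfolding overlap_def less_Suc_eq_le using Bi
    by (intro sum_mono card_mono) (auto intro: basis_of_finite)
  moreover have "P I" using I by (simp add: P_def)
  ultimately obtain I' where I': "P I'" and maximal: "\<And>J. P J \<Longrightarrow> overlap J \<le> overlap I'"
    using ex_has_greatest_nat[of P I overlap] by blast
  have "card (I' i) = CARD('n)" if "i < t" for i
  proof (rule ccontr)
    assume ne: "card (I' i) \<noteq> CARD('n)"
    have indep: "vec.independent (I' i)" using I' \<open>i < t\<close> by (simp add: P_def)
    have "\<not> B i \<subseteq> vec.span (I' i)"
    proof
      assume "B i \<subseteq> vec.span (I' i)"
      then have "vec.span (I' i) = UNIV"
        using basis_of_span[OF Bi[OF \<open>i < t\<close>]] by (metis vec.span_mono vec.span_span top.extremum_uniqueI)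
      then show False
        using ne vec.dim_span_eq_card_independent[OF indep] by (metis vec_dim_card)
    qed
    then obtain e where e: "e \<in> B i" "e \<notin> vec.span (I' i)" by blast
    then have "e \<notin> I' i" by (auto intro: vec.span_base)
    \<comment> \<open>Therefore removing \<open>e\<close> from another member loses no
      overlap.\<close>
    have eB: "e \<notin> B j" if "j < t" "j \<noteq> i" for j
      using B \<open>i < t\<close> that e(1) unfolding disjoint_bases_def disjoint_family_on_def by auto
    define J where "J j = (if j = i then insert e (I' i) else I' j - {e})" for j
    have "P J"
      unfolding P_def
    proof (intro conjI allI impI)
      fix j assume "j < t"
      then show "J j \<subseteq> E"
        using I' e(1) Bi[OF \<open>i < t\<close>] unfolding P_def J_def basis_of_def by auto
      show "vec.independent (J j)"
        using I' vec.independent_insertI[OF e(2) indep] vec.independent_mono[of "I' j" "J j"] \<open>j < t\<close>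
        unfolding P_def by (cases "j = i") (auto simp: J_def)
    next
      show "disjoint_family_on J {..<t}"
        unfolding disjoint_family_on_def
      proof (intro ballI impI)
        fix j k assume jk: "j \<in> {..<t}" "k \<in> {..<t}" "j \<noteq> k"
        then have "I' j \<inter> I' k = {}"
          using I' unfolding P_def disjoint_family_on_def by blast
        then show "J j \<inter> J k = {}" using jk(3) by (auto simp: J_def)
      qed
    next
      have "(\<Union>j<t. I' j) \<subseteq> (\<Union>j<t. J j)"
        using \<open>i < t\<close> by (auto simp: J_def)
      then show "?Z \<subseteq> (\<Union>j<t. J j)" using I' unfolding P_def by blast
    qed
    moreover have "overlap I' < overlap J"
      unfolding overlap_def
    proof (rule sum_strict_mono_ex1)
      have fin: "finite (J j \<inter> B j)" if "j < t" for j
        using Bi[OF that] basis_of_finite by blast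
      show "\<forall>j\<in>{..<t}. card (I' j \<inter> B j) \<le> card (J j \<inter> B j)"
      proof
        fix j assume "j \<in> {..<t}"
        then show "card (I' j \<inter> B j) \<le> card (J j \<inter> B j)"
          using eB[of j] fin[of j] unfolding J_def by (intro card_mono) (auto split: if_splits)
      qed
      have "I' i \<inter> B i \<subset> J i \<inter> B i"
        using e(1) \<open>e \<notin> I' i\<close> by (auto simp: J_def)
      then show "\<exists>j\<in>{..<t}. card (I' j \<inter> B j) < card (J j \<inter> B j)"
        using fin \<open>i < t\<close> psubset_card_mono by blast
    qed simp
    ultimately show False using maximal by (meson not_less)
  qed
  then have "disjoint_bases E t I'"
    using I' by (auto simp: P_def disjoint_bases_def basis_of_def)
  then show ?thesis using I' by (auto simp: P_def)
qed

lemma basis_of_exchange: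
  fixes B :: "('a::field ^ 'n) set"
  assumes "basis_of E B" and "x \<in> B" and "z \<in> E" and "z \<notin> vec.span (B - {x})"
  shows "basis_of E (insert z (B - {x}))"
proof -
  have "z \<notin> B - {x}" using assms(4) by (metis vec.span_base)
  moreover have "finite B" using assms(1) by (rule basis_of_finite)
  moreover have "vec.independent (insert z (B - {x}))"
    using assms vec.independent_mono[of B "B - {x}"]
    by (intro vec.independent_insertI) (auto simp: basis_of_def)
  moreover have "card (insert z (B - {x})) = card B"
    using calculation(1,2) assms(2) by (metis card_Suc_Diff1 card_insert_disjoint finite_Diff)
  ultimately show ?thesis
    using assms by (auto simp: basis_of_def)
qed

text \<open>Expand \<open>x\<close> in the basis \<open>B'\<close>. As \<open>x\<close> is not in
  the span of \<open>B - {x}\<close>, neither is some \<open>z\<close> with nonzero coefficient. The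
  position of \<open>z\<close> lets it replace \<open>x\<close> in \<open>B\<close>; its coefficient
  lets \<open>x\<close> replace it in \<open>B'\<close>.\<close>

lemma symmetric_basis_exchange:
  fixes B B' :: "('a::field ^ 'n) set"
  assumes B: "basis_of E B" and B': "basis_of E B'" and x: "x \<in> B"
  shows "\<exists>z\<in>B'. basis_of E (insert z (B - {x})) \<and> basis_of E (insert x (B' - {z}))"
proof -
  let ?r = "vec.representation B' x"
  have indep': "vec.independent B'" and indep: "vec.independent B"
    using B B' by (simp_all add: basis_of_def)
  have x_not: "x \<notin> vec.span (B - {x})"
    using indep x vec.dependent_def by blast
  have "\<exists>z. ?r z \<noteq> 0 \<and> z \<notin> vec.span (B - {x})"
  proof (rule ccontr)
    assume "\<not> ?thesis"
    then have "(\<Sum>z | ?r z \<noteq> 0. ?r z *s z) \<in> vec.span (B - {x})"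
      by (intro vec.span_sum vec.span_scale) auto
    then show False
      using x_not vec.sum_nonzero_representation_eq[OF indep', of x] basis_of_span[OF B'] by simp
  qed
  then obtain z where z: "?r z \<noteq> 0" "z \<notin> vec.span (B - {x})" by blast
  have "z \<in> B'" using z(1) by (rule vec.representation_ne_zero)
  have "x \<notin> vec.span (B' - {z})"
  proof
    assume "x \<in> vec.span (B' - {z})"
    then have "?r = vec.representation (B' - {z}) x"
      by (intro vec.representation_extend indep') auto
    then show False using z(1) vec.representation_ne_zero[of "B' - {z}" x z] by auto
  qed
  moreover have "z \<in> E" "x \<in> E" using \<open>z \<in> B'\<close> x B B' by (auto simp: basis_of_def)
  ultimately show ?thesis
    using \<open>z \<in> B'\<close> z(2) x B B' basis_of_exchange by blast
qed

text \<open>Keep the union of the bases fixed and maximize the sum of their numbers of colors. A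
  basis with a repeated color then admits a symmetric exchange with a basis of entirely different
  colors, and this exchange increases the sum.\<close>

lemma disjoint_bases_imp_rainbow:
  fixes E :: "('a::field ^ 'n) set" and c :: "'a ^ 'n \<Rightarrow> 'c"
  assumes "disjoint_bases E t B" and "t * (CARD('n) - 1) < card (c ` (\<Union>i<t. B i))"
  shows "\<exists>B'. disjoint_bases E t B' \<and> (\<forall>i<t. inj_on c (B' i))"
proof -
  define P where "P B' \<longleftrightarrow> disjoint_bases E t B' \<and> (\<Union>i<t. B' i) = (\<Union>i<t. B i)" for B'
  define colors where "colors B' = (\<Sum>i<t. card (c ` B' i))" for B' :: "nat \<Rightarrow> ('a ^ 'n) set"
  have "colors B' < Suc (t * CARD('n))" if "P B'" for B'
  proof -
    have "card (c ` B' i) \<le> CARD('n)" if "i < t" for i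
      using \<open>P B'\<close> that unfolding P_def disjoint_bases_def
      by (metis basis_of_def basis_of_finite card_image_le)
    then have "colors B' \<le> (\<Sum>i<t. CARD('n))"
      unfolding colors_def by (intro sum_mono) auto
    then show ?thesis by simp
  qed
  moreover have "P B" using assms(1) by (simp add: P_def)
  ultimately obtain A where A: "P A" and maximal: "\<And>B'. P B' \<Longrightarrow> colors B' \<le> colors A"
    using ex_has_greatest_nat[of P B colors] by blast
  have Ai: "basis_of E (A i)" if "i < t" for i
    using A that by (simp add: P_def disjoint_bases_def)
  have fin: "finite (A i)" and cardA: "card (A i) = CARD('n)" if "i < t" for i
    using Ai[OF that] by (auto simp: basis_of_def intro: basis_of_finite)
  have "inj_on c (A i)" if "i < t" for i
  proof (rule ccontr)
    assume "\<not> inj_on c (A i)"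
    then obtain x y where xy: "x \<in> A i" "y \<in> A i" "x \<noteq> y" "c x = c y"
      by (auto simp: inj_on_def)
    have "\<exists>j<t. j \<noteq> i \<and> c ` A j \<inter> c ` A i = {}"
    proof (rule ccontr)
      assume none: "\<not> ?thesis"
      \<comment> \<open>Each color is credited to \<open>A i\<close> if it occurs there, and
        otherwise to every basis containing it. The repetition in \<open>A i\<close>, and a color
        shared with \<open>A i\<close> in each other basis, leave at most
        \<open>CARD('n) - 1\<close> colors per basis.\<close>
      define D where "D j = (if j = i then c ` A i else c ` A j - c ` A i)" for j
      have D: "card (D j) \<le> CARD('n) - 1" if "j < t" for j
      proof (cases "j = i")
        case True
        have "card (c ` A i) < card (A i)"
          using \<open>\<not> inj_on c (A i)\<close> fin[OF \<open>i < t\<close>] card_image_le eq_card_imp_inj_on le_neq_implies_less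
          by blast
        then show ?thesis using True cardA[OF \<open>i < t\<close>] by (simp add: D_def)
      next
        case False
        then have "c ` A j - c ` A i \<subset> c ` A j" using none that by blast
        then have "card (D j) < card (c ` A j)"
          using False fin[OF that] by (simp add: D_def psubset_card_mono)
        also have "\<dots> \<le> CARD('n)" using card_image_le[OF fin[OF that]] cardA[OF that] by metis
        finally show ?thesis by simp
      qed
      have "c ` (\<Union>i<t. B i) = c ` (\<Union>j<t. A j)" using A by (simp add: P_def)
      also have "\<dots> \<subseteq> (\<Union>j<t. D j)" using \<open>i < t\<close> by (fastforce simp: D_def)
      finally have "card (c ` (\<Union>i<t. B i)) \<le> card (\<Union>j<t. D j)"
        using fin \<open>i < t\<close> by (intro card_mono) (auto simp: D_def)
      also have "\<dots> \<le> (\<Sum>j<t. card (D j))" by (rule card_UN_le) simp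
      also have "\<dots> \<le> (\<Sum>j<t. CARD('n) - 1)" using D by (intro sum_mono) auto
      finally show False using assms(2) by simp
    qed
    then obtain j where j: "j < t" "j \<noteq> i" "c ` A j \<inter> c ` A i = {}" by blast
    obtain z where z: "z \<in> A j" "basis_of E (insert z (A i - {x}))" "basis_of E (insert x (A j - {z}))"
      using symmetric_basis_exchange[OF Ai[OF \<open>i < t\<close>] Ai[OF j(1)] xy(1)] by blast
    define A' where "A' = A(i := insert z (A i - {x}), j := insert x (A j - {z}))"
    have disj: "disjoint_family_on A {..<t}"
      using A by (simp add: P_def disjoint_bases_def)
    have owner: "k = l" if "e \<in> A k" "e \<in> A l" "k < t" "l < t" for e k l
      using disj that unfolding disjoint_family_on_def by blast
    have "P A'"
      unfolding P_def disjoint_bases_def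
    proof (intro conjI allI impI)
      show "basis_of E (A' k)" if "k < t" for k
        using that z Ai by (simp add: A'_def)
      show "disjoint_family_on A' {..<t}"
        unfolding disjoint_family_on_def
      proof (intro ballI impI)
        fix k l assume kl: "k \<in> {..<t}" "l \<in> {..<t}" "k \<noteq> l"
        have "k = l" if "e \<in> A' k" "e \<in> A' l" for e
          using that kl z(1) xy(1) owner \<open>i < t\<close> j(1,2) unfolding A'_def
          by (auto split: if_splits)
        then show "A' k \<inter> A' l = {}" using kl(3) by blast
      qed
      have "(\<Union>k<t. A' k) = (\<Union>k<t. A k)"
      proof (intro equalityI subsetI)
        fix e assume "e \<in> (\<Union>k<t. A' k)"
        then show "e \<in> (\<Union>k<t. A k)"
          using z(1) xy(1) \<open>i < t\<close> j(1) by (auto simp: A'_def split: if_splits)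
      next
        fix e assume "e \<in> (\<Union>k<t. A k)"
        then obtain k where k: "k < t" "e \<in> A k" by blast
        consider "e = x" | "e = z" | "e \<noteq> x" "e \<noteq> z" by blast
        then show "e \<in> (\<Union>k<t. A' k)"
        proof cases
          case 1 then show ?thesis using j(1) by (auto simp: A'_def)
        next
          case 2 then have "e \<in> A' i" using j(2) by (simp add: A'_def)
          then show ?thesis using \<open>i < t\<close> by blast
        next
          case 3 then have "e \<in> A' k" using k by (auto simp: A'_def)
          then show ?thesis using k(1) by blast
        qed
      qed
      then show "(\<Union>k<t. A' k) = (\<Union>i<t. B i)" using A by (simp add: P_def)
    qed
    moreover have "colors A < colors A'"
      unfolding colors_def
    proof (rule sum_strict_mono_ex1)
      have ci: "c ` A' i = insert (c z) (c ` A i)"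
      proof -
        \<comment> \<open>The element \<open>y\<close> remains and keeps the color of
          \<open>x\<close> present.\<close>
        have "c ` (A i - {x}) = c ` A i" using xy by (auto simp: image_iff)
        then show ?thesis using j(2) by (simp add: A'_def)
      qed
      have "c z \<notin> c ` A i" using j(3) z(1) by blast
      then have lt: "card (c ` A i) < card (c ` A' i)"
        using ci fin[OF \<open>i < t\<close>] by simp
      then show "\<exists>k\<in>{..<t}. card (c ` A k) < card (c ` A' k)" using \<open>i < t\<close> by blast
      \<comment> \<open>\<open>A j\<close> may lose the color of \<open>z\<close>, but the color of
        \<open>x\<close> is new to it.\<close>
      have le: "card (c ` A j) \<le> card (c ` A' j)"
      proof -
        have "c x \<notin> c ` A j" using j(3) xy(1) by blast
        then have "card (c ` A' j) = Suc (card (c ` (A j - {z})))"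
          using fin[OF j(1)] by (auto simp: A'_def card_insert_if)
        moreover have "card (c ` A j) \<le> card (insert (c z) (c ` (A j - {z})))"
          using fin[OF j(1)] by (intro card_mono) auto
        then have "card (c ` A j) \<le> Suc (card (c ` (A j - {z})))"
          using fin[OF j(1)] by (simp add: card_insert_if split: if_splits)
        ultimately show ?thesis by simp
      qed
      show "\<forall>k\<in>{..<t}. card (c ` A k) \<le> card (c ` A' k)"
      proof
        fix k
        show "card (c ` A k) \<le> card (c ` A' k)"
          using lt le by (cases "k = i \<or> k = j") (auto simp: A'_def)
      qed
    qed simp
    ultimately show False using maximal by (meson not_less)
  qed
  then show ?thesis using A by (auto simp: P_def)
qed

section \<open>A sufficient condition for disjoint rainbow bases\<close>

lemma has_disjoint_rainbow_bases_if_many_colors: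
  fixes E :: "('a::field ^ 'n) set"
  assumes "finite E"
    and size: "\<And>S. vec.subspace S \<Longrightarrow> t * (CARD('n) - vec.dim S) \<le> card (E - S)"
    and colors: "\<And>S. vec.subspace S \<Longrightarrow> Suc (t * (CARD('n) - 1)) \<le> card (c ` (E - S)) + t * vec.dim S"
  shows "has_disjoint_rainbow_bases E c t"
proof -
  have dim_le: "vec.dim S \<le> CARD('n)" for S :: "('a ^ 'n) set"
    using vec.dim_subset_UNIV[of S] by (simp add: vec.dimension_def card_cart_basis)
  \<comment> \<open>With the identity as coloring, \<open>rainbow_independent_family\<close> gives
    disjoint independent sets of total size at least \<open>t * CARD('n)\<close>, which must all be
    bases.\<close>
  have "t * CARD('n) \<le> card ((\<lambda>e. e) ` (E - S)) + t * vec.dim S" if "vec.subspace S" for S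
    using size[OF that] dim_le[of S] by (simp add: diff_mult_distrib2)
  from rainbow_independent_family[OF \<open>finite E\<close> this]
  obtain I where I: "\<forall>i<t. I i \<subseteq> E \<and> vec.independent (I i)" "disjoint_family_on I {..<t}"
    "t * CARD('n) \<le> (\<Sum>i<t. card (I i))" by blast
  have le: "card (I i) \<le> CARD('n)" if "i < t" for i
    using I(1) that dim_le[of "I i"] vec.dim_eq_card_independent[of "I i"] by simp
  have "card (I i) = CARD('n)" if "i < t" for i
  proof (rule ccontr)
    assume "card (I i) \<noteq> CARD('n)"
    then have "(\<Sum>i<t. card (I i)) < (\<Sum>i<t. CARD('n))"
      using le that by (intro sum_strict_mono_ex1) (auto intro!: bexI[of _ i] simp: le_neq_implies_less)
    with I(3) show False by simp
  qed
  with I have "disjoint_bases E t I" by (simp add: disjoint_bases_def basis_of_def)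
  moreover obtain Z where Z: "\<forall>i<t. Z i \<subseteq> E \<and> vec.independent (Z i)" "disjoint_family_on Z {..<t}"
    "inj_on c (\<Union>i<t. Z i)" "Suc (t * (CARD('n) - 1)) \<le> (\<Sum>i<t. card (Z i))"
    using rainbow_independent_family[OF \<open>finite E\<close> colors] by blast
  ultimately obtain B where B: "disjoint_bases E t B" "(\<Union>i<t. Z i) \<subseteq> (\<Union>i<t. B i)"
    using extend_to_disjoint_bases[OF _ Z(1,2)] by blast
  have finB: "finite (\<Union>i<t. B i)"
    using B(1) by (auto simp: disjoint_bases_def intro: basis_of_finite)
  have "card (c ` (\<Union>i<t. Z i)) = (\<Sum>i<t. card (Z i))"
    unfolding card_image[OF Z(3)]
    using Z(1,2) \<open>finite E\<close> by (intro card_UN_disjoint) (auto simp: disjoint_family_on_def intro: finite_subset)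
  moreover have "card (c ` (\<Union>i<t. Z i)) \<le> card (c ` (\<Union>i<t. B i))"
    using finB B(2) by (intro card_mono image_mono finite_imageI)
  ultimately have "t * (CARD('n) - 1) < card (c ` (\<Union>i<t. B i))"
    using Z(4) by linarith
  from disjoint_bases_imp_rainbow[OF B(1) this]
  obtain B' where B': "disjoint_bases E t B'" "\<forall>i<t. inj_on c (B' i)" by blast
  \<comment> \<open>Nonempty disjoint sets are distinct, so passing from the family to a set of
    bases keeps the number \<open>t\<close>.\<close>
  have ne: "B' i \<noteq> {}" if "i < t" for i
    using B'(1) that unfolding disjoint_bases_def basis_of_def by fastforce
  have disj: "B' i \<inter> B' j = {}" if "i < t" "j < t" "i \<noteq> j" for i j
    using B'(1) that by (auto simp: disjoint_bases_def disjoint_family_on_def)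
  have "inj_on B' {..<t}"
    using ne disj by (intro inj_onI) (metis Int_absorb lessThan_iff)
  then have "card (B' ` {..<t}) = t" by (simp add: card_image)
  moreover have "pairwise disjnt (B' ` {..<t})"
    using disj by (auto simp: pairwise_def disjnt_def)
  moreover have "\<forall>X\<in>B' ` {..<t}. rainbow_basis E c X"
    using B' by (auto simp: rainbow_basis_def disjoint_bases_def)
  ultimately show ?thesis
    unfolding has_disjoint_rainbow_bases_def by (intro exI[of _ "B' ` {..<t}"]) auto
qed

section \<open>Colorings without disjoint rainbow bases\<close>

lemma basis_of_card_Diff_subspace:
  fixes B :: "('a::field ^ 'n) set"
  assumes "basis_of E B"
  shows "CARD('n) - vec.dim S \<le> card (B - S)"
proof -
  have "card (B \<inter> S) \<le> vec.dim S"
    using assms vec.independent_mono[of B "B \<inter> S"]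
    by (intro vec.independent_card_le_dim) (auto simp: basis_of_def)
  moreover have "card (B - S) = CARD('n) - card (B \<inter> S)"
    using assms basis_of_finite[OF assms] by (simp add: card_Diff_subset_Int basis_of_def)
  ultimately show ?thesis by linarith
qed

text \<open>Both obstructions come from this count: \<open>X\<close> is first all of
  \<open>E - S\<close>, then the set of individually colored elements outside
  \<open>S\<close>.\<close>

lemma disjoint_parts_card_le:
  assumes "finite \<B>" and "pairwise disjnt \<B>" and "finite X"
    and "\<And>B. B \<in> \<B> \<Longrightarrow> k \<le> card (B \<inter> X)"
  shows "card \<B> * k \<le> card X"
proof -
  have "card \<B> * k \<le> (\<Sum>B\<in>\<B>. card (B \<inter> X))"
    using sum_mono[of \<B> "\<lambda>_. k"] assms(4) by simp
  also have "\<dots> = card (\<Union>B\<in>\<B>. B \<inter> X)"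
    using assms(1-3) by (intro card_UN_disjoint[symmetric]) (auto simp: pairwise_def disjnt_def)
  also have "\<dots> \<le> card X" using assms(3) by (intro card_mono) auto
  finally show ?thesis .
qed

lemma no_disjoint_bases_if_few_outside:
  fixes E :: "('a::field ^ 'n) set"
  assumes "finite E" and "card (E - S) < t * (CARD('n) - vec.dim S)"
  shows "\<not> has_disjoint_rainbow_bases E c t"
proof
  assume "has_disjoint_rainbow_bases E c t"
  then obtain \<B> where \<B>: "finite \<B>" "card \<B> = t" "pairwise disjnt \<B>"
      and basis: "\<And>B. B \<in> \<B> \<Longrightarrow> basis_of E B"
    unfolding has_disjoint_rainbow_bases_def rainbow_basis_def by blast
  have "card \<B> * (CARD('n) - vec.dim S) \<le> card (E - S)"
  proof (rule disjoint_parts_card_le)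
    fix B assume "B \<in> \<B>"
    then have "B \<inter> (E - S) = B - S" using basis by (auto simp: basis_of_def)
    then show "CARD('n) - vec.dim S \<le> card (B \<inter> (E - S))"
      using basis_of_card_Diff_subspace[OF basis[OF \<open>B \<in> \<B>\<close>]] by simp
  qed (use \<B> assms(1) in auto)
  with assms(2) \<B>(2) show False by simp
qed

text \<open>A rainbow basis has at least \<open>CARD('n) - vec.dim S\<close> elements outside
  \<open>S\<close>, at most one of them with the common color 0. All others lie in \<open>X\<close>,
  which has one element too few for \<open>t\<close> disjoint bases.\<close>

lemma subspace_value_avoiding:
  fixes E :: "('a::field ^ 'n) set"
  assumes "finite E" and "0 < t * (CARD('n) - vec.dim S - 1)"
    and large: "t * (CARD('n) - vec.dim S - 1) \<le> card (E - S)"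
  shows "card (S \<inter> E) + t * (CARD('n) - vec.dim S - 1) \<in> avoiding_color_numbers E t"
proof -
  let ?p = "t * (CARD('n) - vec.dim S - 1)"
  have "?p - 1 \<le> card (E - S)" using large by simp
  then obtain X where X: "X \<subseteq> E - S" "card X = ?p - 1" "finite X"
    by (rule obtain_subset_with_card_n)
  obtain h :: "'a ^ 'n \<Rightarrow> nat" where h: "inj_on h E"
    using \<open>finite E\<close> finite_imp_inj_to_nat_seg by metis
  define Y where "Y = (S \<inter> E) \<union> X"
  define c where "c e = (if e \<in> Y then Suc (h e) else 0)" for e
  have "Y \<subseteq> E" using X(1) by (auto simp: Y_def)
  have cardY: "card Y = card (S \<inter> E) + (?p - 1)"
    unfolding Y_def X(2)[symmetric] using X \<open>finite E\<close> by (intro card_Un_disjoint) auto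
  \<comment> \<open>Some element outside \<open>S\<close> is left over, so color 0 really occurs and
    makes up for the one missing in \<open>?p - 1\<close>.\<close>
  have "card X < card (E - S)" using X(2) large assms(2) by linarith
  then obtain e where "e \<in> E - S" "e \<notin> X"
    using X(3) by (metis card_mono not_less subsetI)
  then have "c ` E = insert 0 ((\<lambda>e. Suc (h e)) ` Y)"
    using \<open>Y \<subseteq> E\<close> unfolding c_def Y_def by (auto simp: image_iff)
  moreover have "card ((\<lambda>e. Suc (h e)) ` Y) = card Y"
    using inj_on_subset[OF h \<open>Y \<subseteq> E\<close>] by (intro card_image) (auto simp: inj_on_def)
  moreover have "finite Y" using \<open>Y \<subseteq> E\<close> \<open>finite E\<close> finite_subset by blast
  ultimately have "card (c ` E) = card (S \<inter> E) + ?p"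
    using cardY assms(2) by (simp add: card_insert_if image_iff)
  moreover have "\<not> has_disjoint_rainbow_bases E c t"
  proof
    assume "has_disjoint_rainbow_bases E c t"
    then obtain \<B> where \<B>: "finite \<B>" "card \<B> = t" "pairwise disjnt \<B>"
        and rainbow: "\<And>B. B \<in> \<B> \<Longrightarrow> rainbow_basis E c B"
      unfolding has_disjoint_rainbow_bases_def by blast
    have "card \<B> * (CARD('n) - vec.dim S - 1) \<le> card X"
    proof (rule disjoint_parts_card_le)
      fix B assume "B \<in> \<B>"
      then have B: "basis_of E B" "inj_on c B" using rainbow by (auto simp: rainbow_basis_def)
      have "B \<subseteq> E" "finite B" using B(1) basis_of_finite by (auto simp: basis_of_def)
      have "c ` (B - S - X) \<subseteq> {0}" by (auto simp: c_def Y_def)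
      then have "card (B - S - X) \<le> 1"
        using card_inj_on_le[of c "B - S - X" "{0}"] inj_on_subset[OF B(2), of "B - S - X"] by auto
      moreover have "B - S = (B \<inter> X) \<union> (B - S - X)" using X(1) by auto
      then have "card (B - S) \<le> card (B \<inter> X) + card (B - S - X)"
        by (metis card_Un_le)
      ultimately show "CARD('n) - vec.dim S - 1 \<le> card (B \<inter> X)"
        using basis_of_card_Diff_subspace[OF B(1), of S] by linarith
    qed (use \<B> X in auto)
    then have "?p \<le> ?p - 1" unfolding \<B>(2) X(2) .
    with assms(2) show False by linarith
  qed
  ultimately show ?thesis by (auto simp: avoiding_color_numbers_def)
qed

section \<open>The extremal number of colors\<close>

theorem theorem19:
  fixes E :: "('a::field ^ 'n) set" and t :: nat
  assumes "CARD('n) \<ge> 2" and "t > 0" and "finite E" and "vec.span E = UNIV"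
  shows "((\<exists>S\<^sub>0. vec.subspace S\<^sub>0 \<and> card E - card (E \<inter> S\<^sub>0) < t * (CARD('n) - vec.dim S\<^sub>0))
            \<longrightarrow> ar_l E t = card E)
       \<and> (\<not> (\<exists>S\<^sub>0. vec.subspace S\<^sub>0 \<and> card E - card (E \<inter> S\<^sub>0) < t * (CARD('n) - vec.dim S\<^sub>0))
            \<longrightarrow> ar_l E t = Max {card (S \<inter> E) + t * (CARD('n) - vec.dim S - 1) | S.
                                 vec.subspace S \<and> vec.dim S \<le> CARD('n) - 2})"
proof -
  have outside: "card E - card (E \<inter> S) = card (E - S)" for S
    using \<open>finite E\<close> by (simp add: card_Diff_subset_Int)
  note finite_colors = finite_avoiding_color_numbers[OF \<open>finite E\<close>]
  let ?vals = "{card (S \<inter> E) + t * (CARD('n) - vec.dim S - 1) | S.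
    vec.subspace S \<and> vec.dim S \<le> CARD('n) - 2}"
  show ?thesis
    unfolding outside
  proof (intro conjI impI)
    assume "\<exists>S\<^sub>0. vec.subspace S\<^sub>0 \<and> card (E - S\<^sub>0) < t * (CARD('n) - vec.dim S\<^sub>0)"
    then have none: "\<not> has_disjoint_rainbow_bases E c t" for c
      using no_disjoint_bases_if_few_outside[OF \<open>finite E\<close>] by blast
    obtain h :: "'a ^ 'n \<Rightarrow> nat" where "inj_on h E"
      using \<open>finite E\<close> finite_imp_inj_to_nat_seg by metis
    then have "card E \<in> avoiding_color_numbers E t"
      using none card_image unfolding avoiding_color_numbers_def by blast
    then show "ar_l E t = card E"
      unfolding ar_l_def using finite_colors \<open>finite E\<close>
      by (intro Max_eqI) (auto simp: avoiding_color_numbers_def card_image_le)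
  next
    assume "\<nexists>S\<^sub>0. vec.subspace S\<^sub>0 \<and> card (E - S\<^sub>0) < t * (CARD('n) - vec.dim S\<^sub>0)"
    then have size: "t * (CARD('n) - vec.dim S) \<le> card (E - S)" if "vec.subspace S" for S
      using that by (meson not_less)
    have upper: "m \<le> Max ?vals" if avoiding: "m \<in> avoiding_color_numbers E t" for m
    proof (rule ccontr)
      assume "\<not> m \<le> Max ?vals"
      then have m: "card (S \<inter> E) + t * (CARD('n) - vec.dim S - 1) < m"
        if "vec.subspace S" "vec.dim S \<le> CARD('n) - 2" for S
      proof -
        have "card (S \<inter> E) + t * (CARD('n) - vec.dim S - 1) \<le> Max ?vals"
          using that by (intro Max_ge finite_subspace_values \<open>finite E\<close>) blast
        with \<open>\<not> m \<le> Max ?vals\<close> show ?thesis by linarith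
      qed
      obtain c where c: "card (c ` E) = m" "\<not> has_disjoint_rainbow_bases E c t"
        using avoiding by (auto simp: avoiding_color_numbers_def)
      have "Suc (t * (CARD('n) - 1)) \<le> card (c ` (E - S)) + t * vec.dim S" if S: "vec.subspace S" for S
      proof -
        \<comment> \<open>The excess of \<open>m\<close> over the values of the formula controls
          dimensions up to \<open>CARD('n) - 2\<close>. For a hyperplane one color outside
          \<open>S\<close> is enough, and \<open>size\<close> provides an element there; for the
          whole space the dimension term alone suffices.\<close>
        consider "vec.dim S \<le> CARD('n) - 2" | "vec.dim S = CARD('n) - 1" | "CARD('n) \<le> vec.dim S"
          by linarith
        then show ?thesis
        proof cases
          case 1
          have "c ` E = c ` (S \<inter> E) \<union> c ` (E - S)" by auto
          then have "m \<le> card (c ` (S \<inter> E)) + card (c ` (E - S))"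
            using c(1) by (metis card_Un_le)
          moreover have "card (c ` (S \<inter> E)) \<le> card (S \<inter> E)"
            using \<open>finite E\<close> by (simp add: card_image_le)
          moreover have "t * (CARD('n) - vec.dim S - 1) + t * vec.dim S = t * (CARD('n) - 1)"
            using 1 assms(1) by (simp flip: distrib_left)
          ultimately show ?thesis using m[OF S 1] by linarith
        next
          case 2
          then have "0 < card (E - S)" using size[OF S] assms(1,2) by simp
          then have "0 < card (c ` (E - S))" using \<open>finite E\<close> by (simp add: card_gt_0_iff)
          then show ?thesis using 2 by simp
        next
          case 3
          have "t * (CARD('n) - 1) < t * CARD('n)" using assms(1,2) by simp
          also have "\<dots> \<le> t * vec.dim S" using 3 by simp
          finally show ?thesis by linarith
        qed
      qed
      then show False
        using has_disjoint_rainbow_bases_if_many_colors[OF \<open>finite E\<close> size] c(2) by blast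
    qed
    have "?vals \<subseteq> avoiding_color_numbers E t"
    proof
      fix v assume "v \<in> ?vals"
      then obtain S where S: "v = card (S \<inter> E) + t * (CARD('n) - vec.dim S - 1)"
        "vec.subspace S" "vec.dim S \<le> CARD('n) - 2" by blast
      \<comment> \<open>The case assumption leaves enough elements outside \<open>S\<close> for the
        coloring, and the bound on \<open>vec.dim S\<close> makes the required number
        positive.\<close>
      have "t * (CARD('n) - vec.dim S - 1) \<le> t * (CARD('n) - vec.dim S)"
        by (intro mult_le_mono2) simp
      also have "\<dots> \<le> card (E - S)" using size[OF S(2)] .
      finally show "v \<in> avoiding_color_numbers E t"
        unfolding S(1) using S(3) assms(1,2) by (intro subspace_value_avoiding \<open>finite E\<close>) auto
    qed
    then have "Max ?vals \<in> avoiding_color_numbers E t"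
      using Max_in[OF finite_subspace_values[OF \<open>finite E\<close>] subspace_values_nonempty] by blast
    then show "ar_l E t = Max ?vals"
      unfolding ar_l_def using finite_colors upper by (intro Max_eqI) auto
  qed
qed

end
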